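(* Let $f:\mathbb{N}\to\mathbb{C}$ with $f(k)\neq 0$ for all $k\geq 1$, and let $t\in\mathbb{C}$, $t\neq 0$. For any integers $p\geq 1$ and $n\geq 0$, \begin{align*} F_n^{(p+1)}(t) ={}& F_n^{(p)}(t) + \frac{(p+1)(-1)^{p}\, t^{n(n+1)/2}}{t^{\frac{pn(n+1)}{2(p+1)}}\; n!_{f}}\genfrac{[}{]}{0pt}{}{n+1}{p+2}_{f(t^{1/(p+1)})}\\ &+\sum_{j=0}^{p-1}\frac{p\,(-1)^{j+1}\,t^{n(n+1)/2}}{t^{\frac{jn(n+1)}{2p}}\,(n!_{f})^{p-j}\,(p-j)}\left(\sum_{\substack{0\leq i_1,\ldots,i_{p-j}\leq j\\ i_1+\cdots+i_{p-j}=j}}\genfrac{[}{]}{0pt}{}{n+1}{i_1+2}_{f(t^{1/p})}\cdots\genfrac{[}{]}{0pt}{}{n+1}{i_{p-j}+2}_{f(t^{1/p})}\right)\\ &+\sum_{j=0}^{p-1}\sum_{i=0}^{j}\frac{(p+1)\,t^{n(n+1)/2}(-1)^{j}}{t^{\frac{jn(n+1)}{2(p+1)}}\,(n!_{f})^{p+1-j}\,(p+1-j)}\genfrac{[}{]}{0pt}{}{n+1}{i+2}_{f(t^{1/(p+1)})}\left(\sum_{\substack{0\leq i_1,\ldots,i_{p-j}\leq j-i\\ i_1+\cdots+i_{p-j}=j-i}}\ \prod_{m=1}^{p-j}\genfrac{[}{]}{0pt}{}{n+1}{i_m+2}_{f(t^{1/(p+1)})}\right). \end{align*}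
   Context: Generalized Stirling numbers of the first kind: for $f:\mathbb{N}\to\mathbb{C}$, nonzero $s\in\mathbb{C}$ and integers $n,k\geq 1$, $$\genfrac{[}{]}{0pt}{}{n}{k}_{f(s)} := [x^{k-1}]\prod_{j=1}^{n-1}\left(x+\frac{f(j)}{s^j}\right),$$ the coefficient of $x^{k-1}$ in the product (the empty product is $1$). The subscript $f(t^{1/q})$ means that the parameter $s$ is taken to be $s=t^{1/q}$. The $f$-factorial is $n!_f := \prod_{j=1}^n f(j)$ (with $0!_f=1$). The $p$-order $f$-harmonic numbers are $F_n^{(p)}(t) := \sum_{k=1}^{n}\frac{t^k}{f(k)^p}$ (with $F_0^{(p)}(t)=0$). Fractional powers: for each $q\in\{p,p+1\}$, $t^{1/q}$ denotes a fixed $q$-th root of $t$, and for integers $a$, $t^{\frac{a n(n+1)}{2q}}$ means $(t^{1/q})^{a n(n+1)/2}$ with that same root. *)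

theory Defs
  imports Complex_Main "HOL-Library.FuncSet" "HOL-Computational_Algebra.Polynomial"
begin

text \<open>Meaningful for \<open>s \<noteq> 0\<close> and \<open>n, k \<ge> 1\<close>.\<close>

definition gen_stirling1 :: "(nat \<Rightarrow> complex) \<Rightarrow> complex \<Rightarrow> nat \<Rightarrow> nat \<Rightarrow> complex" where
  "gen_stirling1 f s n k = coeff (\<Prod>j=1..n-1. [:f j / s ^ j, 1:]) (k - 1)"

definition f_fact :: "(nat \<Rightarrow> complex) \<Rightarrow> nat \<Rightarrow> complex" where
  "f_fact f n = (\<Prod>j=1..n. f j)"

definition f_harmonic :: "(nat \<Rightarrow> complex) \<Rightarrow> nat \<Rightarrow> nat \<Rightarrow> complex \<Rightarrow> complex" where
  "f_harmonic f p n t = (\<Sum>k=1..n. t ^ k / f k ^ p)"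

text \<open>The \<open>m\<close>-tuples \<open>(i\<^sub>1, \<dots>, i\<^sub>m)\<close> with \<open>0 \<le> i\<^sub>1, \<dots>, i\<^sub>m \<le> s\<close> and
  \<open>i\<^sub>1 + \<dots> + i\<^sub>m = s\<close>, encoded as functions on \<open>{1..m}\<close>; extensionality makes distinct
  functions correspond to distinct tuples.\<close>

definition index_tuples :: "nat \<Rightarrow> nat \<Rightarrow> (nat \<Rightarrow> nat) set" where
  "index_tuples m s = {i \<in> {1..m} \<rightarrow>\<^sub>E {0..s}. (\<Sum>l=1..m. i l) = s}"

end

theory Submission
  imports Defs "HOL-Computational_Algebra.Polynomial_FPS"
begin

text \<open>
  The identity is the difference of two instances of one expansion. Let \<open>s ^ r = t\<close> and
  \<open>y\<^sub>k = s ^ k / f k\<close>, so that \<open>t ^ k / f k ^ r = y\<^sub>k ^ r\<close> and the harmonic number of order \<open>r\<close> is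
  the \<open>r\<close>-th power sum \<open>p\<^sub>r\<close> of \<open>y\<^sub>1, \<dots>, y\<^sub>n\<close>. The polynomial \<open>E(x) = \<Prod>k. (1 + y\<^sub>k x)\<close> is \<open>c\<close> times
  the polynomial whose coefficients are the generalized Stirling numbers, where
  \<open>c = s ^ (n (n + 1) / 2) / n!\<^sub>f\<close>.

  Up to sign and a factor \<open>r\<close>, the power sums are the coefficients of a logarithm:
  \<open>log E(x) = \<Sum>r\<ge>1. (-1) ^ (r - 1) p\<^sub>r x ^ r / r\<close>. Writing \<open>E(x) = 1 + x A(x)\<close> and expanding
  \<open>log (1 + x A(x)) = \<Sum>m\<ge>1. (-1) ^ (m - 1) x ^ m A(x) ^ m / m\<close>, comparison of the coefficients of
  \<open>x ^ r\<close> gives, with \<open>m = r - j\<close>,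
  \<open>p\<^sub>r = \<Sum>j<r. r (-1) ^ j / (r - j) * [x ^ j] A(x) ^ (r - j)\<close>
  (\<open>power_sum_eq_coeff_powers\<close>). Since
  \<open>c ^ (r - j) = t ^ (n (n + 1) / 2) / (s ^ (j n (n + 1) / 2) n!\<^sub>f ^ (r - j))\<close>, this expresses the harmonic number in Stirling numbers
  (\<open>f_harmonic_eq_coeff_powers\<close>).

  The order \<open>p\<close>, with \<open>s = u\<close>, yields the negative of the sum containing \<open>u\<close> in the theorem, once
  the powers of \<open>A\<close> are multiplied out over index tuples
  (\<open>coeff_power_eq_sum_index_tuples\<close>); that sum therefore cancels the harmonic number of
  order \<open>p\<close>. The order \<open>p + 1\<close>, with \<open>s = v\<close>, yields the remaining terms: the summand \<open>j = p\<close>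
  involves only the first power of \<open>A\<close> and is a single Stirling number, and in the other summands
  one factor of \<open>A ^ (p + 1 - j)\<close> is split off by the Cauchy product.
\<close>

section \<open>Power sums and the formal logarithm\<close>

unbundle fps_syntax

lemma fps_deriv_ln_compose:
  fixes Q :: "'a :: field_char_0 fps"
  assumes "Q $ 0 = 1"
  shows "fps_deriv (fps_ln 1 oo (Q - 1)) = inverse Q * fps_deriv Q"
proof -
  have Q0: "(Q - 1) $ 0 = 0"
    using assms by simp
  have "inverse (1 + fps_X) oo (Q - 1) = inverse ((1 + fps_X) oo (Q - 1))"
    using Q0 by (intro fps_inverse_compose) auto
  also have "(1 + fps_X) oo (Q - 1) = Q"
    using Q0 by (simp add: fps_compose_add_distrib)
  finally show ?thesis
    using Q0 by (simp add: fps_compose_deriv fps_ln_deriv)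
qed

text \<open>The two sides have no constant term and the same derivative, because the logarithmic
  derivative is additive.\<close>

lemma fps_ln_compose_mult:
  fixes P Q :: "'a :: field_char_0 fps"
  assumes P: "P $ 0 = 1" and Q: "Q $ 0 = 1"
  shows "fps_ln 1 oo (P * Q - 1) = (fps_ln 1 oo (P - 1)) + (fps_ln 1 oo (Q - 1))"
proof -
  have inv: "inverse P * P = 1" "inverse Q * Q = 1"
    using P Q by (simp_all add: inverse_mult_eq_1)
  have "inverse (P * Q) * fps_deriv (P * Q) =
      (inverse Q * Q) * (inverse P * fps_deriv P) + (inverse P * P) * (inverse Q * fps_deriv Q)"
    by (simp add: fps_inverse_mult algebra_simps)
  hence "fps_deriv (fps_ln 1 oo (P * Q - 1)) =
      fps_deriv ((fps_ln 1 oo (P - 1)) + (fps_ln 1 oo (Q - 1)))"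
    using P Q inv by (simp add: fps_deriv_ln_compose)
  thus ?thesis
    unfolding fps_deriv_eq_iff by simp
qed

lemma fps_ln_compose_prod:
  fixes Q :: "'b \<Rightarrow> 'a :: field_char_0 fps"
  assumes "finite I" and "\<And>k. k \<in> I \<Longrightarrow> Q k $ 0 = 1"
  shows "fps_ln 1 oo ((\<Prod>k\<in>I. Q k) - 1) = (\<Sum>k\<in>I. fps_ln 1 oo (Q k - 1))"
  using assms
proof (induction I rule: finite_induct)
  case (insert k I)
  have "(\<Prod>k\<in>I. Q k) $ 0 = 1"
    using insert.hyps(1) insert.prems by (induction I rule: finite_induct) auto
  with insert show ?case
    by (simp add: fps_ln_compose_mult)
qed simp

lemma fps_ln_compose_linear_nth:
  fixes y :: "'a :: field_char_0"
  assumes "r \<ge> 1"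
  shows "(fps_ln 1 oo (fps_const y * fps_X)) $ r = (-1) ^ (r - 1) * y ^ r / of_nat r"
  using assms by (simp only: fps_nth_compose_linear fps_ln_nth) (simp add: mult.commute)

text \<open>Since \<open>(x A) ^ m = x ^ m A ^ m\<close>, the \<open>m\<close>-th term of the logarithmic series sees only the
  coefficient of \<open>x ^ (r - m)\<close> in \<open>A ^ m\<close>; the summation index is \<open>j = r - m\<close>.\<close>

lemma fps_ln_compose_nth:
  fixes A :: "'a :: field_char_0 fps"
  assumes "r \<ge> 1"
  shows "(fps_ln 1 oo (fps_X * A)) $ r =
    (\<Sum>j<r. (-1) ^ (r - 1 - j) / of_nat (r - j) * (A ^ (r - j)) $ j)"
proof -
  have "(fps_ln 1 oo (fps_X * A)) $ r =
      (\<Sum>m=0..r. fps_ln 1 $ m * (A ^ m) $ (r - m))"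
    unfolding fps_compose_nth
    by (intro sum.cong) (auto simp: power_mult_distrib fps_X_power_mult_nth)
  also have "\<dots> = (\<Sum>m=1..r. fps_ln 1 $ m * (A ^ m) $ (r - m))"
    by (intro sum.mono_neutral_right) (auto simp: not_less_eq_eq)
  also have "\<dots> = (\<Sum>j<r. fps_ln 1 $ (r - j) * (A ^ (r - j)) $ j)"
    by (rule sum.reindex_bij_witness[of _ "\<lambda>j. r - j" "\<lambda>m. r - m"]) auto
  also have "\<dots> = (\<Sum>j<r. (-1) ^ (r - 1 - j) / of_nat (r - j) * (A ^ (r - j)) $ j)"
    by (intro sum.cong) (auto simp: fps_ln_nth)
  finally show ?thesis .
qed

text \<open>A form of the Newton--Girard formulas solved for the power sums: \<open>A\<close> carries the elementary
  symmetric polynomials of positive degree, and both sides are \<open>(-1) ^ (r - 1) r\<close> times the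
  coefficient of \<open>x ^ r\<close> in \<open>log (1 + x A(x))\<close>.\<close>

lemma power_sum_eq_coeff_powers:
  fixes y :: "'b \<Rightarrow> 'a :: field_char_0" and A :: "'a poly"
  assumes I: "finite I" and A: "(\<Prod>k\<in>I. [:1, y k:]) = pCons 1 A" and r: "r \<ge> 1"
  shows "(\<Sum>k\<in>I. y k ^ r) =
    (\<Sum>j<r. of_nat r * (-1) ^ j / of_nat (r - j) * coeff (A ^ (r - j)) j)"
proof -
  let ?L = "fps_ln 1 oo (fps_X * fps_of_poly A)"
  have "1 + fps_X * fps_of_poly A = (\<Prod>k\<in>I. 1 + fps_const (y k) * fps_X)"
    using arg_cong[OF A, of fps_of_poly]
    by (simp add: fps_of_poly_prod fps_of_poly_pCons algebra_simps)
  hence "?L = fps_ln 1 oo ((\<Prod>k\<in>I. 1 + fps_const (y k) * fps_X) - 1)"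
    by (metis add_diff_cancel_left')
  also have "\<dots> = (\<Sum>k\<in>I. fps_ln 1 oo (fps_const (y k) * fps_X))"
    by (subst fps_ln_compose_prod) (use I in auto)
  finally have "?L $ r = (\<Sum>k\<in>I. (-1) ^ (r - 1) * y k ^ r / of_nat r)"
    using r by (simp add: fps_sum_nth fps_ln_compose_linear_nth del: fps_nth_compose_linear)
  also have "\<dots> = (-1) ^ (r - 1) / of_nat r * (\<Sum>k\<in>I. y k ^ r)"
    by (simp add: sum_distrib_left)
  finally have log_coeff: "(-1) ^ (r - 1) / of_nat r * (\<Sum>k\<in>I. y k ^ r) =
      (\<Sum>j<r. (-1) ^ (r - 1 - j) / of_nat (r - j) * coeff (A ^ (r - j)) j)"
    using r by (simp add: fps_ln_compose_nth flip: fps_of_poly_power)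
  have "(\<Sum>k\<in>I. y k ^ r) =
      of_nat r * (-1) ^ (r - 1) * ((-1) ^ (r - 1) / of_nat r * (\<Sum>k\<in>I. y k ^ r))"
    using r by (simp flip: power_add mult_2)
  also have "\<dots> = (\<Sum>j<r. of_nat r * (-1) ^ (r - 1) *
      ((-1) ^ (r - 1 - j) / of_nat (r - j) * coeff (A ^ (r - j)) j))"
    unfolding log_coeff by (rule sum_distrib_left)
  also have "\<dots> = (\<Sum>j<r. of_nat r * (-1) ^ j / of_nat (r - j) * coeff (A ^ (r - j)) j)"
  proof (intro sum.cong refl)
    fix j assume "j \<in> {..<r}"
    hence sign: "(r - 1) + (r - 1 - j) = j + 2 * (r - 1 - j)"
      by simp
    have "of_nat r * (-1) ^ (r - 1) *
        ((-1) ^ (r - 1 - j) / of_nat (r - j) * coeff (A ^ (r - j)) j) =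
        of_nat r * ((-1) ^ (r - 1) * (-1) ^ (r - 1 - j)) / of_nat (r - j) * coeff (A ^ (r - j)) j"
      by simp
    also have "(-1 :: 'a) ^ (r - 1) * (-1) ^ (r - 1 - j) = (-1) ^ (j + 2 * (r - 1 - j))"
      by (simp only: sign flip: power_add)
    also have "\<dots> = (-1) ^ j"
      by (simp add: power_add power_mult)
    finally show "of_nat r * (-1) ^ (r - 1) *
        ((-1) ^ (r - 1 - j) / of_nat (r - j) * coeff (A ^ (r - j)) j) =
        of_nat r * (-1) ^ j / of_nat (r - j) * coeff (A ^ (r - j)) j" .
  qed
  finally show ?thesis .
qed

section \<open>Powers of a polynomial as sums over index tuples\<close>

lemma prod_monom:
  fixes c :: "'b \<Rightarrow> 'a :: comm_semiring_1"
  shows "(\<Prod>l\<in>I. monom (c l) (e l)) = monom (\<Prod>l\<in>I. c l) (\<Sum>l\<in>I. e l)"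
  by (induction I rule: infinite_finite_induct) (simp_all add: mult_monom)

text \<open>Multiplying out \<open>(\<Sum>i\<le>degree B. b\<^sub>i x ^ i) ^ m\<close> gives one monomial for every choice of exponents
  from \<open>{..degree B}\<close>; both this choice set and the set of tuples are cut down to the common
  subset on which the sum is \<open>s\<close> and all exponents are at most \<open>degree B\<close>.\<close>

lemma coeff_power_eq_sum_index_tuples:
  fixes B :: "complex poly"
  shows "coeff (B ^ m) s = (\<Sum>i\<in>index_tuples m s. \<Prod>l=1..m. coeff B (i l))"
proof -
  let ?D = "{1..m} \<rightarrow>\<^sub>E {..degree B}"
  have "B ^ m = (\<Prod>l=1..m. \<Sum>e\<le>degree B. monom (coeff B e) e)"
    by (simp add: poly_as_sum_of_monoms)
  also have "\<dots> = (\<Sum>i\<in>?D. \<Prod>l=1..m. monom (coeff B (i l)) (i l))"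
    by (rule prod_sum_PiE) auto
  also have "\<dots> = (\<Sum>i\<in>?D. monom (\<Prod>l=1..m. coeff B (i l)) (\<Sum>l=1..m. i l))"
    by (simp only: prod_monom)
  finally have "coeff (B ^ m) s =
      (\<Sum>i\<in>?D. if (\<Sum>l=1..m. i l) = s then \<Prod>l=1..m. coeff B (i l) else 0)"
    by (simp add: coeff_sum del: One_nat_def)
  also have "\<dots> = (\<Sum>i\<in>?D \<inter> index_tuples m s. \<Prod>l=1..m. coeff B (i l))"
  proof (intro sum.mono_neutral_cong_right ballI)
    show "finite ?D"
      by (intro finite_PiE) auto
    fix i assume i: "i \<in> ?D - ?D \<inter> index_tuples m s"
    have "i \<in> index_tuples m s" if s: "(\<Sum>l=1..m. i l) = s"
    proof -
      have "i l \<le> s" if "l \<in> {1..m}" for l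
        unfolding s[symmetric] using that by (intro member_le_sum) auto
      thus ?thesis
        using i s by (auto simp: index_tuples_def PiE_iff)
    qed
    thus "(if (\<Sum>l=1..m. i l) = s then \<Prod>l=1..m. coeff B (i l) else 0) = 0"
      using i by auto
  qed (auto simp: index_tuples_def)
  also have "\<dots> = (\<Sum>i\<in>index_tuples m s. \<Prod>l=1..m. coeff B (i l))"
  proof (intro sum.mono_neutral_left ballI)
    have "finite ({1..m} \<rightarrow>\<^sub>E {0..s})"
      by (intro finite_PiE) auto
    thus "finite (index_tuples m s)"
      by (rule finite_subset[rotated]) (auto simp: index_tuples_def)
    fix i assume i: "i \<in> index_tuples m s - ?D \<inter> index_tuples m s"
    then obtain l where "l \<in> {1..m}" "i l > degree B"
      by (auto simp: index_tuples_def PiE_iff not_le)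
    thus "(\<Prod>l=1..m. coeff B (i l)) = 0"
      by (intro prod_zero bexI[of _ l]) (auto simp: coeff_eq_0)
  qed auto
  finally show ?thesis .
qed

section \<open>Harmonic numbers in terms of generalized Stirling numbers\<close>

definition stirling_poly :: "(nat \<Rightarrow> complex) \<Rightarrow> complex \<Rightarrow> nat \<Rightarrow> complex poly" where
  "stirling_poly f s n = (\<Prod>j=1..n. [:f j / s ^ j, 1:])"

text \<open>Without its constant term, whose value is \<open>n!\<^sub>f / s ^ (n (n + 1) / 2)\<close>, the Stirling polynomial
  starts with the Stirling number of lower index 2; hence the offset in the index.\<close>

lemma coeff_poly_shift_stirling_poly:
  "coeff (poly_shift 1 (stirling_poly f s n)) i = gen_stirling1 f s (n + 1) (i + 2)"
  by (simp add: coeff_poly_shift stirling_poly_def gen_stirling1_def)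

lemma prod_power_eq_power_triangle:
  fixes s :: "'a :: comm_semiring_1"
  shows "(\<Prod>k=1..n. s ^ k) = s ^ (n * (n + 1) div 2)"
  by (simp add: power_sum[symmetric] Sum_Icc_nat)

text \<open>Dividing each factor \<open>x + f k / s ^ k\<close> by its constant term turns it into \<open>1 + x s ^ k / f k\<close>.\<close>

lemma prod_linear_eq_smult_stirling_poly:
  assumes f: "\<And>k. k \<ge> 1 \<Longrightarrow> f k \<noteq> 0" and s: "s \<noteq> 0"
  shows "(\<Prod>k=1..n. [:1, s ^ k / f k:]) =
    smult (s ^ (n * (n + 1) div 2) / f_fact f n) (stirling_poly f s n)"
proof -
  have "(\<Prod>k=1..n. [:1, s ^ k / f k:]) = (\<Prod>k=1..n. smult (s ^ k / f k) [:f k / s ^ k, 1:])"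
    using f s by (intro prod.cong) auto
  also have "\<dots> = smult (\<Prod>k=1..n. s ^ k / f k) (stirling_poly f s n)"
    unfolding stirling_poly_def by (rule prod_smult)
  also have "(\<Prod>k=1..n. s ^ k / f k) = s ^ (n * (n + 1) div 2) / f_fact f n"
    by (simp only: prod_dividef prod_power_eq_power_triangle f_fact_def)
  finally show ?thesis .
qed

lemma f_harmonic_eq_coeff_powers:
  assumes f: "\<And>k. k \<ge> 1 \<Longrightarrow> f k \<noteq> 0" and t: "t \<noteq> 0" and r: "r \<ge> 1" and s: "s ^ r = t"
  shows "f_harmonic f r n t =
    (\<Sum>j<r. (of_nat r * (-1) ^ j * t ^ (n * (n + 1) div 2))
        / (s ^ (j * (n * (n + 1) div 2)) * f_fact f n ^ (r - j) * of_nat (r - j))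
      * coeff (poly_shift 1 (stirling_poly f s n) ^ (r - j)) j)"
proof -
  define N where "N = n * (n + 1) div 2"
  define c where "c = s ^ N / f_fact f n"
  define B where "B = poly_shift 1 (stirling_poly f s n)"
  have s0: "s \<noteq> 0"
    using s t r by auto
  \<comment> \<open>The constant term is read off from the product, all other coefficients from the
    Stirling polynomial.\<close>
  have "coeff (\<Prod>k=1..n. [:1, s ^ k / f k:]) 0 = 1"
    by (simp add: poly_prod flip: poly_0_coeff_0)
  moreover have E: "(\<Prod>k=1..n. [:1, s ^ k / f k:]) = smult c (stirling_poly f s n)"
    unfolding c_def N_def using f s0 by (rule prod_linear_eq_smult_stirling_poly)
  ultimately have E': "(\<Prod>k=1..n. [:1, s ^ k / f k:]) = pCons 1 (smult c B)"
    by (auto simp: poly_eq_iff coeff_pCons coeff_poly_shift B_def split: nat.splits)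
  have "f_harmonic f r n t = (\<Sum>k=1..n. (s ^ k / f k) ^ r)"
    unfolding f_harmonic_def s[symmetric]
    by (intro sum.cong) (simp_all add: power_divide mult.commute flip: power_mult)
  also have "\<dots> = (\<Sum>j<r. of_nat r * (-1) ^ j / of_nat (r - j) * coeff (smult c B ^ (r - j)) j)"
    using E' r by (intro power_sum_eq_coeff_powers) auto
  also have "\<dots> = (\<Sum>j<r. (of_nat r * (-1) ^ j * t ^ N)
        / (s ^ (j * N) * f_fact f n ^ (r - j) * of_nat (r - j)) * coeff (B ^ (r - j)) j)"
  proof (intro sum.cong refl)
    fix j assume "j \<in> {..<r}"
    \<comment> \<open>Of the \<open>r\<close> factors \<open>s ^ N\<close> making up \<open>t ^ N\<close>, only \<open>r - j\<close> occur in \<open>c ^ (r - j)\<close>; the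
      missing \<open>j\<close> are the source of the fractional power of \<open>t\<close> in the denominator.\<close>
    hence "t ^ N = s ^ (j * N) * s ^ (N * (r - j))"
      unfolding s[symmetric] by (simp flip: power_mult power_add add: algebra_simps)
    hence "c ^ (r - j) = t ^ N / (s ^ (j * N) * f_fact f n ^ (r - j))"
      using s0 by (simp add: c_def power_divide power_mult)
    thus "of_nat r * (-1) ^ j / of_nat (r - j) * coeff (smult c B ^ (r - j)) j =
        (of_nat r * (-1) ^ j * t ^ N)
        / (s ^ (j * N) * f_fact f n ^ (r - j) * of_nat (r - j)) * coeff (B ^ (r - j)) j"
      by (simp add: smult_power divide_inverse mult_ac)
  qed
  finally show ?thesis
    unfolding B_def N_def .
qed

theorem proposition2p3:
  fixes f :: "nat \<Rightarrow> complex" and t u v :: complex and p n :: nat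
  assumes f_nz: "\<And>k. k \<ge> 1 \<Longrightarrow> f k \<noteq> 0"
    and t_nz: "t \<noteq> 0"
    and p_pos: "p \<ge> 1"
    and u_root: "u ^ p = t"
    and v_root: "v ^ (p + 1) = t"
  shows "f_harmonic f (p + 1) n t =
    f_harmonic f p n t
    + (of_nat (p + 1) * (-1) ^ p * t ^ (n * (n + 1) div 2))
        / (v ^ (p * (n * (n + 1) div 2)) * f_fact f n)
      * gen_stirling1 f v (n + 1) (p + 2)
    + (\<Sum>j=0..p-1.
        (of_nat p * (-1) ^ (j + 1) * t ^ (n * (n + 1) div 2))
          / (u ^ (j * (n * (n + 1) div 2)) * f_fact f n ^ (p - j) * of_nat (p - j))
        * (\<Sum>i\<in>index_tuples (p - j) j.
             \<Prod>m=1..p-j. gen_stirling1 f u (n + 1) (i m + 2)))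
    + (\<Sum>j=0..p-1. \<Sum>i=0..j.
        (of_nat (p + 1) * t ^ (n * (n + 1) div 2) * (-1) ^ j)
          / (v ^ (j * (n * (n + 1) div 2)) * f_fact f n ^ (p + 1 - j) * of_nat (p + 1 - j))
        * gen_stirling1 f v (n + 1) (i + 2)
        * (\<Sum>i'\<in>index_tuples (p - j) (j - i).
             \<Prod>m=1..p-j. gen_stirling1 f v (n + 1) (i' m + 2)))"
proof -
  define N where "N = n * (n + 1) div 2"
  define F where "F = f_fact f n"
  define U where "U = poly_shift 1 (stirling_poly f u n)"
  define V where "V = poly_shift 1 (stirling_poly f v n)"
  have range: "{0..p - 1} = {..<p}"
    using p_pos by auto
  have U: "gen_stirling1 f u (n + 1) (i + 2) = coeff U i" for i
    unfolding U_def by (rule coeff_poly_shift_stirling_poly[symmetric])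
  have V: "gen_stirling1 f v (n + 1) (i + 2) = coeff V i" for i
    unfolding V_def by (rule coeff_poly_shift_stirling_poly[symmetric])

  \<comment> \<open>Both harmonic numbers are handled through coefficients of powers of \<open>U\<close> and \<open>V\<close>; sums
    over index tuples enter only when the two expansions are combined at the end.\<close>
  have order_p: "f_harmonic f p n t =
      (\<Sum>j<p. (of_nat p * (-1) ^ j * t ^ N) / (u ^ (j * N) * F ^ (p - j) * of_nat (p - j))
        * coeff (U ^ (p - j)) j)"
    unfolding N_def F_def U_def
    using f_nz t_nz p_pos u_root by (rule f_harmonic_eq_coeff_powers)
  have "f_harmonic f (p + 1) n t =
      (\<Sum>j<p + 1. (of_nat (p + 1) * (-1) ^ j * t ^ N)
        / (v ^ (j * N) * F ^ (p + 1 - j) * of_nat (p + 1 - j)) * coeff (V ^ (p + 1 - j)) j)"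
    unfolding N_def F_def V_def
    by (rule f_harmonic_eq_coeff_powers) (use f_nz t_nz v_root in simp_all)
  also have "\<dots> =
      (of_nat (p + 1) * (-1) ^ p * t ^ N) / (v ^ (p * N) * F) * coeff V p +
      (\<Sum>j<p. (of_nat (p + 1) * (-1) ^ j * t ^ N)
        / (v ^ (j * N) * F ^ (p + 1 - j) * of_nat (p + 1 - j)) * coeff (V ^ (p + 1 - j)) j)"
    by simp
  also have "(\<Sum>j<p. (of_nat (p + 1) * (-1) ^ j * t ^ N)
        / (v ^ (j * N) * F ^ (p + 1 - j) * of_nat (p + 1 - j)) * coeff (V ^ (p + 1 - j)) j) =
      (\<Sum>j<p. \<Sum>i=0..j. (of_nat (p + 1) * t ^ N * (-1) ^ j)
        / (v ^ (j * N) * F ^ (p + 1 - j) * of_nat (p + 1 - j)) * coeff V i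
        * coeff (V ^ (p - j)) (j - i))"
  proof (intro sum.cong refl)
    fix j assume "j \<in> {..<p}"
    hence "V ^ (p + 1 - j) = V * V ^ (p - j)"
      by (simp add: Suc_diff_le)
    thus "(of_nat (p + 1) * (-1) ^ j * t ^ N)
        / (v ^ (j * N) * F ^ (p + 1 - j) * of_nat (p + 1 - j)) * coeff (V ^ (p + 1 - j)) j =
      (\<Sum>i=0..j. (of_nat (p + 1) * t ^ N * (-1) ^ j)
        / (v ^ (j * N) * F ^ (p + 1 - j) * of_nat (p + 1 - j)) * coeff V i
        * coeff (V ^ (p - j)) (j - i))"
      by (simp only: coeff_mult atLeast0AtMost sum_distrib_left) (simp only: mult_ac)
  qed
  finally have order_Suc_p: "f_harmonic f (p + 1) n t =
      (of_nat (p + 1) * (-1) ^ p * t ^ N) / (v ^ (p * N) * F) * coeff V p +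
      (\<Sum>j<p. \<Sum>i=0..j. (of_nat (p + 1) * t ^ N * (-1) ^ j)
        / (v ^ (j * N) * F ^ (p + 1 - j) * of_nat (p + 1 - j)) * coeff V i
        * coeff (V ^ (p - j)) (j - i))" .
  have "(\<Sum>j<p. (of_nat p * (-1) ^ (j + 1) * t ^ N)
        / (u ^ (j * N) * F ^ (p - j) * of_nat (p - j)) * coeff (U ^ (p - j)) j) =
      - f_harmonic f p n t"
    unfolding order_p by (simp add: sum_negf)
  with order_Suc_p show ?thesis
    unfolding range U V N_def[symmetric] F_def[symmetric]
      coeff_power_eq_sum_index_tuples[symmetric]
    by simp
qed

end
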